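(* Let $A\in\mathbb{R}^{m\times n}$, let $c\geq 1$, and let $\mathcal{J}\subset\{1,\ldots,n\}$ be a given column index set with $|\mathcal{J}|=r$. Suppose $\mathcal{I}\subset\{1,\ldots,m\}$ is a row index set with $|\mathcal{I}|=r$ such that $A_{\mathcal{I},\mathcal{J}}$ is nonsingular and $$A_{:,\mathcal{J}}=UA_{\mathcal{I},\mathcal{J}},\qquad U=P\begin{pmatrix} I\\ E\end{pmatrix},\qquad E=A_{\{1:m\}\setminus\mathcal{I},\mathcal{J}}A_{\mathcal{I},\mathcal{J}}^{-1},\qquad \Vert E\Vert_{\max}\leq c,$$ where $P$ is an $m\times m$ permutation matrix. For $1\leq i\leq m$ let $\widetilde{\mathcal{I}}_{i}=\mathcal{I}\cup\{i\}$. Then the approximation $A\approx UA_{\mathcal{I},:}$ satisfies $$\Vert A-UA_{\mathcal{I},:}\Vert_{\max}\leq 2c\sqrt{r}\max_{1\leq i\leq m,\,1\leq j\leq n}\ \min_{v\in\mathbb{R}^{r}}\Vert A_{\widetilde{\mathcal{I}}_{i},\mathcal{J}}v-A_{\widetilde{\mathcal{I}}_{i},j}\Vert_{2}.$$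
   Context: For index sets $\mathcal{I}$ (rows) and $\mathcal{J}$ (columns), $A_{\mathcal{I},\mathcal{J}}$ is the submatrix of $A$ with rows in $\mathcal{I}$ and columns in $\mathcal{J}$; $A_{:,\mathcal{J}}$ and $A_{\mathcal{I},:}$ are the submatrices of the columns in $\mathcal{J}$ and of the rows in $\mathcal{I}$, respectively; $A_{\mathcal{I},j}$ is the part of column $j$ with rows in $\mathcal{I}$. $1:m$ stands for $1,2,\ldots,m$. $\Vert\cdot\Vert_{\max}$ is the largest entrywise magnitude. The permutation matrix $P$ is the one that places the identity block of $U$ in the rows $\mathcal{I}$ and the block $E$ in the rows $\{1:m\}\setminus\mathcal{I}$, i.e. $U_{\mathcal{I},:}=I$ and $U_{\{1:m\}\setminus\mathcal{I},:}=E$. In the paper $A=(\kappa(x_i,y_j))$ is a (real) kernel matrix, with no particular property of the kernel $\kappa$ being used. *)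

theory Defs
  imports
    "Jordan_Normal_Form.Matrix"
    "Jordan_Normal_Form.DL_Submatrix"
    "Jordan_Normal_Form.Gauss_Jordan_Elimination"
    "HOL-Combinatorics.Permutations"
begin

text \<open>
  Rows and columns are indexed from 0, so an index set of an m-by-n matrix is a subset of
  \<open>{..<m}\<close> or \<open>{..<n}\<close>. The library constant \<open>submatrix A I J\<close> keeps the selected rows and
  columns in increasing order; \<open>UNIV\<close> as an index set stands for a colon.
\<close>

text \<open>The inserted 0 gives the empty matrix norm 0 and changes nothing otherwise.\<close>

definition max_norm :: "real mat \<Rightarrow> real" where
  "max_norm M = Max (insert 0 (abs ` elements_mat M))"

definition norm2 :: "real vec \<Rightarrow> real" where
  "norm2 v = sqrt (\<Sum>i<dim_vec v. (v $ i)\<^sup>2)"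

definition permutation_mat :: "nat \<Rightarrow> real mat \<Rightarrow> bool" where
  "permutation_mat m P \<longleftrightarrow>
    (\<exists>\<pi>. \<pi> permutes {..<m} \<and> P = mat m m (\<lambda>(i, j). if i = \<pi> j then 1 else 0))"

text \<open>
  The minimum is literally the least value of the residual norm; a linear least-squares
  problem always attains it.
\<close>

definition min_residual :: "real mat \<Rightarrow> real vec \<Rightarrow> real" where
  "min_residual M b = (LEAST t. \<exists>v \<in> carrier_vec (dim_col M). t = norm2 (M *\<^sub>v v - b))"

end

theory Submission
  imports Defs
begin

text \<open>
  Fix a column \<open>j\<close> and a row \<open>i \<notin> I\<close>. Let \<open>u\<close> be row \<open>i\<close> of \<open>U\<close>, and let \<open>s\<close> be the \<open>(i, j)\<close>
  entry of the error \<open>A - U A(I, :)\<close>. Because \<open>U\<close> reproduces the columns \<open>J\<close> exactly, the residual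
  of a trial vector \<open>v\<close> on all rows is
  \<open>A(:, J) v - A(:, j) = U x - (A(:, j) - U A(I, j))\<close>, where \<open>x = A(I, J) v - A(I, j)\<close> is its part
  on the rows \<open>I\<close> (\<open>residual_interpolation\<close>). Restricted to the rows \<open>I \<union> {i}\<close>, its squared norm is
  therefore \<open>\<bar>x\<bar>\<^sup>2 + (u \<bullet> x - s)\<^sup>2\<close>. As \<open>A(I, J)\<close> is nonsingular, \<open>x\<close> ranges over all vectors when
  \<open>v\<close> does, and the least-squares problem can be solved in closed form
  (\<open>ridge_sum_decomposition\<close>): the minimal residual norm is \<open>\<bar>s\<bar> / sqrt (1 + \<bar>u\<bar>\<^sup>2)\<close>
  (\<open>min_residual_extra_row\<close>).

  The error entry \<open>\<bar>s\<bar>\<close> is thus \<open>sqrt (1 + \<bar>u\<bar>\<^sup>2)\<close> times one of the numbers whose maximum is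
  taken. The entries of \<open>u\<close> are entries of \<open>E\<close>, so \<open>1 + \<bar>u\<bar>\<^sup>2 \<le> 1 + r c\<^sup>2 \<le> (2 c sqrt r)\<^sup>2\<close>.
  For \<open>i \<in> I\<close> the error entry is 0, because row \<open>i\<close> of \<open>U\<close> is a unit vector.
\<close>


section \<open>The maximum norm\<close>

lemma abs_index_le_max_norm:
  assumes "i < dim_row M" "j < dim_col M"
  shows "\<bar>M $$ (i, j)\<bar> \<le> max_norm M"
proof -
  have "M $$ (i, j) \<in> elements_mat M"
    using assms by auto
  then show ?thesis
    unfolding max_norm_def by (intro Max_ge) (auto simp: elements_mat_def)
qed

lemma max_norm_le:
  assumes "0 \<le> b" "\<And>i j. i < dim_row M \<Longrightarrow> j < dim_col M \<Longrightarrow> \<bar>M $$ (i, j)\<bar> \<le> b"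
  shows "max_norm M \<le> b"
proof -
  have "finite (elements_mat M)"
    by (simp add: elements_mat_def)
  then show ?thesis
    unfolding max_norm_def using assms by (subst Max_le_iff) auto
qed


section \<open>Submatrices\<close>

lemma bij_betw_pick:
  assumes "finite S"
  shows "bij_betw (pick S) {..<card S} S"
proof (rule bij_betwI')
  fix k l assume "k \<in> {..<card S}" "l \<in> {..<card S}"
  then show "(pick S k = pick S l) = (k = l)"
    using pick_mono_le[of k S l] pick_mono_le[of l S k] by (cases k l rule: linorder_cases) auto
next
  fix k assume "k \<in> {..<card S}"
  then show "pick S k \<in> S"
    by (simp add: pick_in_set_le)
next
  fix a assume "a \<in> S"
  moreover from this have "card {b \<in> S. b < a} < card S"
    using assms by (intro psubset_card_mono) auto
  ultimately show "\<exists>k \<in> {..<card S}. a = pick S k"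
    by (intro bexI[of _ "card {b \<in> S. b < a}"]) (simp_all add: pick_card_in_set)
qed

lemma pick_less:
  assumes "S \<subseteq> {..<m}" "k < card S"
  shows "pick S k < m"
  using pick_in_set_le[OF assms(2)] assms(1) by auto

lemma Collect_less_inter:
  assumes "S \<subseteq> {..<m}"
  shows "{i. i < m \<and> i \<in> S} = S"
  using assms by auto

lemma submatrix_carrier:
  assumes "A \<in> carrier_mat m n" "S \<subseteq> {..<m}" "T \<subseteq> {..<n}"
  shows "submatrix A S T \<in> carrier_mat (card S) (card T)"
  using assms unfolding submatrix_def by (simp add: Collect_less_inter)

lemma submatrix_rows_carrier:
  assumes "A \<in> carrier_mat m n" "S \<subseteq> {..<m}"
  shows "submatrix A S UNIV \<in> carrier_mat (card S) n"
  using assms unfolding submatrix_def by (simp add: Collect_less_inter)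

lemma submatrix_cols_carrier:
  assumes "A \<in> carrier_mat m n" "T \<subseteq> {..<n}"
  shows "submatrix A UNIV T \<in> carrier_mat m (card T)"
  using assms unfolding submatrix_def by (simp add: Collect_less_inter)

lemma index_submatrix_rows:
  assumes "A \<in> carrier_mat m n" "S \<subseteq> {..<m}" "k < card S" "j < n"
  shows "submatrix A S UNIV $$ (k, j) = A $$ (pick S k, j)"
  using assms unfolding submatrix_def by (simp add: Collect_less_inter pick_UNIV)

lemma index_submatrix_residual:
  assumes A: "A \<in> carrier_mat m n" and S: "S \<subseteq> {..<m}" and T: "T \<subseteq> {..<n}"
    and v: "v \<in> carrier_vec (card T)" and j: "j < n" and k: "k < card S"
  shows "(submatrix A S T *\<^sub>v v - col (submatrix A S UNIV) j) $ k
    = (submatrix A UNIV T *\<^sub>v v - col A j) $ pick S k"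
proof -
  note AT = submatrix_cols_carrier[OF A T]
  note AST = submatrix_carrier[OF A S T]
  note AS = submatrix_rows_carrier[OF A S]
  note p = pick_less[OF S k]
  have "row (submatrix A S T) k = row (submatrix A UNIV T) (pick S k)"
    using AT AST p k
    by (intro eq_vecI)
       (auto simp: submatrix_split[of A S T] index_submatrix_rows[OF AT S k])
  then show ?thesis
    using A AT AST AS p k j index_submatrix_rows[OF A S k j] by simp
qed

text \<open>
  The norm of a residual on selected rows, with the enumeration of these rows in increasing order
  replaced by a sum over the row set, which is what makes adding a row to the set tractable.
\<close>

lemma norm2_submatrix_residual:
  assumes A: "A \<in> carrier_mat m n" and S: "S \<subseteq> {..<m}" and T: "T \<subseteq> {..<n}"
    and v: "v \<in> carrier_vec (card T)" and j: "j < n"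
  shows "norm2 (submatrix A S T *\<^sub>v v - col (submatrix A S UNIV) j)
    = sqrt (\<Sum>a\<in>S. ((submatrix A UNIV T *\<^sub>v v - col A j) $ a)\<^sup>2)"
proof -
  let ?w = "submatrix A UNIV T *\<^sub>v v - col A j"
  have fin: "finite S"
    using S finite_subset by blast
  have dim: "dim_vec (submatrix A S T *\<^sub>v v - col (submatrix A S UNIV) j) = card S"
    using submatrix_rows_carrier[OF A S] by simp
  have "norm2 (submatrix A S T *\<^sub>v v - col (submatrix A S UNIV) j)
      = sqrt (\<Sum>k<card S. (?w $ pick S k)\<^sup>2)"
    unfolding norm2_def dim by (simp add: index_submatrix_residual[OF A S T v j] del: index_minus_vec)
  also have "(\<Sum>k<card S. (?w $ pick S k)\<^sup>2) = (\<Sum>a\<in>S. (?w $ a)\<^sup>2)"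
    using sum.reindex_bij_betw[OF bij_betw_pick[OF fin]] by fast
  finally show ?thesis .
qed


section \<open>Least squares with one extra row\<close>

lemma min_residual_eqI:
  assumes "v \<in> carrier_vec (dim_col M)" "norm2 (M *\<^sub>v v - b) = t"
    and "\<And>w. w \<in> carrier_vec (dim_col M) \<Longrightarrow> t \<le> norm2 (M *\<^sub>v w - b)"
  shows "min_residual M b = t"
  unfolding min_residual_def using assms by (intro Least_equality) auto

text \<open>
  Pythagoras for the linear map \<open>x \<mapsto> (x, e \<bullet> x)\<close>: the point \<open>s e / (1 + \<bar>e\<bar>\<^sup>2)\<close> is sent to the
  orthogonal projection of \<open>(0, s)\<close> onto the range of the map, whose distance from \<open>(0, s)\<close> is
  \<open>\<bar>s\<bar> / sqrt (1 + \<bar>e\<bar>\<^sup>2)\<close>.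
\<close>

lemma ridge_sum_decomposition:
  fixes e x :: "'a \<Rightarrow> real" and s :: real and K :: "'a set"
  defines "q \<equiv> 1 + (\<Sum>k\<in>K. (e k)\<^sup>2)"
  shows "(\<Sum>k\<in>K. (x k)\<^sup>2) + ((\<Sum>k\<in>K. e k * x k) - s)\<^sup>2
    = (\<Sum>k\<in>K. (x k - s / q * e k)\<^sup>2) + (\<Sum>k\<in>K. e k * (x k - s / q * e k))\<^sup>2 + s\<^sup>2 / q"
proof -
  have q: "q > 0"
    unfolding q_def by (simp add: add_pos_nonneg sum_nonneg)
  define t where "t = s / q"
  define p where "p = (\<Sum>k\<in>K. e k * x k)"
  have s: "s = t * q"
    using q by (simp add: t_def)
  have Q: "(\<Sum>k\<in>K. (e k)\<^sup>2) = q - 1"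
    by (simp add: q_def)
  have "(x k - t * e k)\<^sup>2 = (x k)\<^sup>2 - 2 * t * (e k * x k) + t\<^sup>2 * (e k)\<^sup>2" for k
    by (simp add: power2_eq_square algebra_simps)
  then have 1: "(\<Sum>k\<in>K. (x k - t * e k)\<^sup>2) = (\<Sum>k\<in>K. (x k)\<^sup>2) - 2 * t * p + t\<^sup>2 * (q - 1)"
    by (simp add: sum.distrib sum_subtractf p_def Q flip: sum_distrib_left)
  have "e k * (x k - t * e k) = e k * x k - t * (e k)\<^sup>2" for k
    by (simp add: power2_eq_square algebra_simps)
  then have 2: "(\<Sum>k\<in>K. e k * (x k - t * e k)) = p - t * (q - 1)"
    by (simp add: sum_subtractf p_def Q flip: sum_distrib_left)
  have 3: "s\<^sup>2 / q = t\<^sup>2 * q"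
    using q by (simp add: s power2_eq_square)
  show ?thesis
    unfolding t_def[symmetric] p_def[symmetric] 1 2 3
    by (simp add: s power2_eq_square algebra_simps)
qed

lemma invertible_mat_solve:
  fixes M :: "'a :: comm_ring_1 mat"
  assumes "M \<in> carrier_mat r r" "invertible_mat M" "b \<in> carrier_vec r"
  obtains v where "v \<in> carrier_vec r" "M *\<^sub>v v = b"
proof -
  obtain B where "M * B = 1\<^sub>m (dim_row M)" and BM: "B * M = 1\<^sub>m (dim_row B)"
    using assms(2) unfolding invertible_mat_def inverts_mat_def by auto
  then have MB: "M * B = 1\<^sub>m r"
    using assms(1) by simp
  have "dim_col B = r"
    using arg_cong[OF MB, of dim_col] by simp
  moreover have "dim_row B = r"
    using arg_cong[OF BM, of dim_col] assms(1) by simp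
  ultimately have B: "B \<in> carrier_mat r r"
    by (intro carrier_matI)
  show ?thesis
  proof
    show "B *\<^sub>v b \<in> carrier_vec r"
      using B assms(3) by simp
    show "M *\<^sub>v (B *\<^sub>v b) = b"
      using assms(1,3) B MB by (simp flip: assoc_mult_mat_vec)
  qed
qed

text \<open>
  The case \<open>i \<in> I\<close>, where adding row \<open>i\<close> leaves the square nonsingular system unchanged.
\<close>

lemma min_residual_square:
  assumes M: "M \<in> carrier_mat r r" and inv: "invertible_mat M" and b: "b \<in> carrier_vec r"
  shows "min_residual M b = 0"
proof -
  obtain v where v: "v \<in> carrier_vec r" "M *\<^sub>v v = b"
    using invertible_mat_solve[OF M inv b] .
  show ?thesis
  proof (rule min_residual_eqI)
    show "v \<in> carrier_vec (dim_col M)" "norm2 (M *\<^sub>v v - b) = 0"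
      using v M b by (auto simp: norm2_def)
  qed (simp add: norm2_def sum_nonneg)
qed

text \<open>
  Column \<open>j\<close> of \<open>A\<close> is its interpolant from the rows \<open>I\<close> plus column \<open>j\<close> of the error, whereas the
  columns \<open>J\<close> are interpolated without error. So the residual is interpolated from its own part on
  the rows \<open>I\<close>, up to the error column.
\<close>

lemma residual_interpolation:
  fixes A U :: "real mat"
  assumes A: "A \<in> carrier_mat m n" and I: "I \<subseteq> {..<m}" and J: "J \<subseteq> {..<n}"
    and U: "U \<in> carrier_mat m (card I)"
    and AJ: "submatrix A UNIV J = U * submatrix A I J"
    and v: "v \<in> carrier_vec (card J)" and j: "j < n"
  shows "submatrix A UNIV J *\<^sub>v v - col A j
    = U *\<^sub>v (submatrix A I J *\<^sub>v v - col (submatrix A I UNIV) j)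
      - col (A - U * submatrix A I UNIV) j"
proof -
  note AIJ = submatrix_carrier[OF A I J]
  note AI = submatrix_rows_carrier[OF A I]
  have "submatrix A UNIV J *\<^sub>v v = U *\<^sub>v (submatrix A I J *\<^sub>v v)"
    unfolding AJ using U AIJ v by (rule assoc_mult_mat_vec)
  moreover have "U *\<^sub>v (submatrix A I J *\<^sub>v v - col (submatrix A I UNIV) j)
      = U *\<^sub>v (submatrix A I J *\<^sub>v v) - U *\<^sub>v col (submatrix A I UNIV) j"
    using U AIJ AI v j by (intro mult_minus_distrib_mat_vec) auto
  moreover have "col (A - U * submatrix A I UNIV) j = col A j - U *\<^sub>v col (submatrix A I UNIV) j"
    using A U AI j by (intro eq_vecI) auto
  ultimately show ?thesis
    using A U AI AIJ v j by (intro eq_vecI) auto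
qed

text \<open>
  The least-squares problem in the unknown \<open>v\<close> is a ridge problem in the unknown \<open>x\<close>, the residual
  on the rows \<open>I\<close>: the square terms of \<open>x\<close> come from these rows, the last term from row \<open>i\<close>.
\<close>

lemma min_residual_extra_row:
  fixes A U :: "real mat"
  assumes A: "A \<in> carrier_mat m n" and I: "I \<subseteq> {..<m}" and J: "J \<subseteq> {..<n}"
    and card: "card I = r" "card J = r"
    and inv: "invertible_mat (submatrix A I J)"
    and U: "U \<in> carrier_mat m r"
    and AJ: "submatrix A UNIV J = U * submatrix A I J"
    and i: "i < m" "i \<notin> I" and j: "j < n"
  shows "min_residual (submatrix A (I \<union> {i}) J) (col (submatrix A (I \<union> {i}) UNIV) j)
    = \<bar>(A - U * submatrix A I UNIV) $$ (i, j)\<bar> / sqrt (1 + (\<Sum>k<r. (U $$ (i, k))\<^sup>2))"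
proof -
  let ?M = "submatrix A (I \<union> {i}) J" and ?b = "col (submatrix A (I \<union> {i}) UNIV) j"
  define s where "s = (A - U * submatrix A I UNIV) $$ (i, j)"
  define e where "e k = U $$ (i, k)" for k
  define q where "q = 1 + (\<Sum>k<r. (e k)\<^sup>2)"
  define x where "x v = submatrix A I J *\<^sub>v v - col (submatrix A I UNIV) j" for v
  have fin: "finite I"
    using I finite_subset by blast
  have Ii: "I \<union> {i} \<subseteq> {..<m}"
    using I i by auto
  have U': "U \<in> carrier_mat m (card I)"
    using U card by simp
  note AIJ = submatrix_carrier[OF A I J, unfolded card]
  note AI = submatrix_rows_carrier[OF A I, unfolded card]
  have dimM: "dim_col ?M = r"
    using submatrix_carrier[OF A Ii J] card by simp
  have q: "q > 0"
    unfolding q_def by (simp add: add_pos_nonneg sum_nonneg)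
  have norm: "norm2 (?M *\<^sub>v v - ?b)
      = sqrt ((\<Sum>k<r. (x v $ k)\<^sup>2) + ((\<Sum>k<r. e k * x v $ k) - s)\<^sup>2)"
    if v: "v \<in> carrier_vec r" for v
  proof -
    let ?w = "submatrix A UNIV J *\<^sub>v v - col A j"
    have v': "v \<in> carrier_vec (card J)"
      using v card by simp
    have xc: "x v \<in> carrier_vec r"
      unfolding x_def using AIJ AI by (auto intro: carrier_vecI)
    have "?w = U *\<^sub>v x v - col (A - U * submatrix A I UNIV) j"
      unfolding x_def using residual_interpolation[OF A I J U' AJ v' j] .
    then have "?w $ i = row U i \<bullet> x v - s"
      using A U AI i j by (simp add: s_def)
    also have "row U i \<bullet> x v = (\<Sum>k<r. e k * x v $ k)"
      using U xc i by (simp add: scalar_prod_def e_def atLeast0LessThan)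
    finally have wi: "?w $ i = (\<Sum>k<r. e k * x v $ k) - s" .
    have "(\<Sum>a\<in>I. (?w $ a)\<^sup>2) = (\<Sum>k<card I. (?w $ pick I k)\<^sup>2)"
      using sum.reindex_bij_betw[OF bij_betw_pick[OF fin], symmetric] by fast
    also have "\<dots> = (\<Sum>k<r. (x v $ k)\<^sup>2)"
      unfolding x_def using index_submatrix_residual[OF A I J v' j] card
      by (simp del: index_minus_vec)
    finally have "(\<Sum>a\<in>I \<union> {i}. (?w $ a)\<^sup>2) = (\<Sum>k<r. (x v $ k)\<^sup>2) + (?w $ i)\<^sup>2"
      using fin i by simp
    then show ?thesis
      unfolding norm2_submatrix_residual[OF A Ii J v' j] wi by simp
  qed
  \<comment> \<open>The minimizer is the \<open>v\<close> whose residual on the rows \<open>I\<close> is \<open>s e / q\<close>, which makes both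
    squares in the Pythagorean decomposition vanish.\<close>
  have "col (submatrix A I UNIV) j + vec r (\<lambda>k. s / q * e k) \<in> carrier_vec r"
    using AI by (intro carrier_vecI) simp
  then obtain v where v: "v \<in> carrier_vec r"
    and "submatrix A I J *\<^sub>v v = col (submatrix A I UNIV) j + vec r (\<lambda>k. s / q * e k)"
    by (rule invertible_mat_solve[OF AIJ inv])
  then have xv: "x v $ k = s / q * e k" if "k < r" for k
    using that AI j unfolding x_def by simp
  have "min_residual ?M ?b = sqrt (s\<^sup>2 / q)"
  proof (rule min_residual_eqI)
    show "v \<in> carrier_vec (dim_col ?M)"
      using v dimM by simp
    show "norm2 (?M *\<^sub>v v - ?b) = sqrt (s\<^sup>2 / q)"
      unfolding norm[OF v] ridge_sum_decomposition q_def[symmetric] using xv by simp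
    fix w :: "real vec" assume "w \<in> carrier_vec (dim_col ?M)"
    then have w: "w \<in> carrier_vec r"
      using dimM by simp
    show "sqrt (s\<^sup>2 / q) \<le> norm2 (?M *\<^sub>v w - ?b)"
      unfolding norm[OF w] ridge_sum_decomposition q_def[symmetric] by (simp add: sum_nonneg)
  qed
  then show ?thesis
    by (simp add: real_sqrt_divide s_def q_def e_def)
qed


section \<open>The error bound\<close>

theorem lemma2p1:
  fixes A P U E :: "real mat" and m n r :: nat and c :: real and I J :: "nat set"
  assumes "A \<in> carrier_mat m n"
    and "c \<ge> 1"
    and "r \<ge> 1"
    and "J \<subseteq> {..<n}" and "card J = r"
    and "I \<subseteq> {..<m}" and "card I = r"
    and "invertible_mat (submatrix A I J)"
    and "E = submatrix A ({..<m} - I) J * the (mat_inverse (submatrix A I J))"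
    and "permutation_mat m P"
    and "U = P * (1\<^sub>m r @\<^sub>r E)"
    and "submatrix U I UNIV = 1\<^sub>m r"
    and "submatrix U ({..<m} - I) UNIV = E"
    and "submatrix A UNIV J = U * submatrix A I J"
    and "max_norm E \<le> c"
  shows "max_norm (A - U * submatrix A I UNIV)
    \<le> 2 * c * sqrt (real r) *
      Max {min_residual (submatrix A (I \<union> {i}) J) (col (submatrix A (I \<union> {i}) UNIV) j) | i j.
             i < m \<and> j < n}"
proof -
  let ?err = "A - U * submatrix A I UNIV"
  let ?res = "\<lambda>i j. min_residual (submatrix A (I \<union> {i}) J) (col (submatrix A (I \<union> {i}) UNIV) j)"
  let ?R = "{?res i j | i j. i < m \<and> j < n}"
  note A = assms(1) and c = assms(2) and r = assms(3) and J = assms(4) and cJ = assms(5)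
    and I = assms(6) and cI = assms(7) and inv = assms(8) and UI = assms(12) and UE = assms(13)
    and AJ = assms(14) and Ec = assms(15)
  note AIJ = submatrix_carrier[OF A I J, unfolded cI cJ]
  note AI = submatrix_rows_carrier[OF A I, unfolded cI]
  have fin: "finite I"
    using I finite_subset by blast
  obtain \<pi> where "P = mat m m (\<lambda>(i, j). if i = \<pi> j then 1 else 0)"
    using assms(10) unfolding permutation_mat_def by auto
  then have U: "U \<in> carrier_mat m r"
    unfolding assms(11) append_rows_def by (auto intro: carrier_matI)
  have res_I: "?res i j = 0" if "i \<in> I" "j < n" for i j
    using min_residual_square[OF AIJ inv, of "col (submatrix A I UNIV) j"] AI that
    by (simp add: insert_absorb)
  have "finite ?R"
    by (rule finite_subset[of _ "(\<lambda>(i, j). ?res i j) ` ({..<m} \<times> {..<n})"]) auto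
  then have res_le: "?res i j \<le> Max ?R" if "i < m" "j < n" for i j
    using that by (intro Max_ge) auto
  \<comment> \<open>As \<open>r \<ge> 1\<close>, there are a row in \<open>I\<close> and a column in \<open>J\<close>; they contribute the value 0.\<close>
  have Max_nonneg: "0 \<le> Max ?R"
  proof -
    obtain i j where "i \<in> I" "j \<in> J"
      using r cI cJ by (metis card.empty equals0I not_one_le_zero)
    then show ?thesis
      using res_le[of i j] res_I[of i j] I J by auto
  qed
  show ?thesis
  proof (rule max_norm_le)
    show "0 \<le> 2 * c * sqrt (real r) * Max ?R"
      using Max_nonneg c by simp
    fix i j assume "i < dim_row ?err" "j < dim_col ?err"
    then have i: "i < m" and j: "j < n"
      using U AI by auto
    show "\<bar>?err $$ (i, j)\<bar> \<le> 2 * c * sqrt (real r) * Max ?R"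
    proof (cases "i \<in> I")
      case True
      then obtain k where k: "k < r" "i = pick I k"
        using bij_betw_pick[OF fin] cI by (auto simp: bij_betw_def)
      have "row U i = unit_vec r k"
      proof (rule eq_vecI)
        fix l assume "l < dim_vec (unit_vec r k :: real vec)"
        then have "l < r"
          by simp
        then show "row U i $ l = unit_vec r k $ l"
          using index_submatrix_rows[OF U I, of k l] k i U
          by (simp add: UI cI split: if_splits)
      qed (use U in simp)
      then have "(U * submatrix A I UNIV) $$ (i, j) = submatrix A I UNIV $$ (k, j)"
        using U AI i j k by simp
      then have "?err $$ (i, j) = 0"
        using index_submatrix_rows[OF A I, of k j] A U AI i j k by (simp add: cI)
      then show ?thesis
        using Max_nonneg c by simp
    next
      case False
      let ?q = "1 + (\<Sum>k<r. (U $$ (i, k))\<^sup>2)"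
      have "\<bar>U $$ (i, k)\<bar> \<le> c" if "k < r" for k
      proof -
        have S: "{..<m} - I \<subseteq> {..<m}"
          by auto
        have "pick ({..<m} - I) ` {..<card ({..<m} - I)} = {..<m} - I"
          by (intro bij_betw_imp_surj_on bij_betw_pick) simp
        moreover have "i \<in> {..<m} - I"
          using False i by simp
        ultimately obtain l where l: "l < card ({..<m} - I)" "i = pick ({..<m} - I) l"
          by (metis imageE lessThan_iff)
        have "E $$ (l, k) = U $$ (i, k)"
          using index_submatrix_rows[OF U S l(1) that] l by (simp add: UE)
        moreover have "E \<in> carrier_mat (card ({..<m} - I)) r"
          using submatrix_rows_carrier[OF U S] by (simp add: UE)
        ultimately show ?thesis
          using abs_index_le_max_norm[of l E k] Ec l that by auto
      qed
      then have "(\<Sum>k<r. (U $$ (i, k))\<^sup>2) \<le> (\<Sum>k<r. c\<^sup>2)"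
        by (intro sum_mono) (use c in \<open>auto simp: abs_le_square_iff[symmetric]\<close>)
      \<comment> \<open>This lets the summand 1 in \<open>1 + \<bar>u\<bar>\<^sup>2\<close> be absorbed into a second \<open>r c\<^sup>2\<close>.\<close>
      moreover have "1 \<le> real r * c\<^sup>2"
        using mult_mono[of 1 "real r" 1 "c\<^sup>2"] r c by (simp add: one_le_power)
      moreover have "(2 * c * sqrt (real r))\<^sup>2 = 4 * (real r * c\<^sup>2)"
        by (simp add: power_mult_distrib)
      ultimately have "?q \<le> (2 * c * sqrt (real r))\<^sup>2"
        by simp
      then have q_le: "sqrt ?q \<le> 2 * c * sqrt (real r)"
        using c by (intro real_le_lsqrt) auto
      have "?q > 0"
        by (simp add: add_pos_nonneg sum_nonneg)
      then have "\<bar>?err $$ (i, j)\<bar> = sqrt ?q * ?res i j"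
        unfolding min_residual_extra_row[OF A I J cI cJ inv U AJ i False j] by simp
      also have "\<dots> \<le> sqrt ?q * Max ?R"
        using res_le[OF i j] by (intro mult_left_mono) (auto simp: sum_nonneg)
      also have "\<dots> \<le> 2 * c * sqrt (real r) * Max ?R"
        using q_le Max_nonneg by (intro mult_right_mono)
      finally show ?thesis .
    qed
  qed
qed

end
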